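(* Let $n>1$. Then \[1-\frac{1}{2^n}<\prod_{p\neq 2}\left(1-\frac{1}{p^n}\right)\] (product over all odd primes), and \[D_n\cap\left(1-\frac{1}{2^n},\ \prod_{p\neq2}\left(1-\frac{1}{p^n}\right)\right)=\emptyset.\] In particular, $D_n$ is not dense in the interval $[1/\zeta(n),1]$.
   Context: For $n\ge1$, $D_n=\left\{\prod_{p\mid b}\left(1-\frac{1}{p^n}\right): b\in\mathbb{Z}\right\}\subseteq[1/\zeta(n),1]$, where the product is over primes dividing $b$ (for $b=0$ it is the product over all primes, equal to $1/\zeta(n)$). $\zeta$ is the Riemann zeta function. *)

theory Defs
  imports "HOL-Analysis.Analysis" "HOL-Computational_Algebra.Primes"
begin

text \<open>The Riemann zeta function on real arguments \<open>s > 1\<close>, via its Dirichlet series.\<close>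

definition zeta :: "real \<Rightarrow> real" where
  "zeta s = (\<Sum>k. 1 / real (Suc k) powr s)"

text \<open>The product of \<open>1 - 1/p^n\<close> over the primes \<open>p \<in> P\<close>. The set of primes involved may be
  infinite, so \<open>prod\<close> over a set (which is then \<open>1\<close>) cannot be used; we use the infinite product
  over \<open>nat\<close>, with the factor \<open>1\<close> at all other indices. For \<open>n > 1\<close> it converges for
  every \<open>P\<close>. (For \<open>n = 1\<close> and all primes it diverges to \<open>0\<close>, where \<open>prodinf\<close> is unspecified.)\<close>

definition euler_factor :: "nat \<Rightarrow> nat set \<Rightarrow> nat \<Rightarrow> real" where
  "euler_factor n P p = (if prime p \<and> p \<in> P then 1 - 1 / real p ^ n else 1)"

definition prime_prod :: "nat \<Rightarrow> nat set \<Rightarrow> real" where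
  "prime_prod n P = prodinf (euler_factor n P)"

text \<open>Here \<open>b = 0\<close> is included: every prime divides it, so it contributes the product over all
  primes.\<close>

definition D :: "nat \<Rightarrow> real set" where
  "D n = {prime_prod n {p. int p dvd b} | b :: int. True}"

lemma euler_factor_has_prod:
  assumes "n > 1"
  shows "euler_factor n P has_prod prime_prod n P"
proof -
  have "summable (\<lambda>p. norm (euler_factor n P p - 1))"
  proof (rule summable_comparison_test')
    show "summable (\<lambda>p. 1 / real p ^ n)"
      using inverse_power_summable[of n, where 'a = real] assms by (simp add: field_simps)
    show "norm (norm (euler_factor n P p - 1)) \<le> 1 / real p ^ n" if "p \<ge> 0" for p
      by (simp add: euler_factor_def)
  qed
  then have "convergent_prod (euler_factor n P)"
    using summable_imp_abs_convergent_prod abs_convergent_prod_imp_convergent_prod by blast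
  then show ?thesis
    unfolding prime_prod_def by (rule convergent_prod_has_prod)
qed

lemma prime_prod_divisors:
  assumes "b \<noteq> 0"
  shows "prime_prod n {p. int p dvd b} = (\<Prod>p | prime p \<and> int p dvd b. 1 - 1 / real p ^ n)"
proof -
  have "{p. prime p \<and> int p dvd b} \<subseteq> {..nat \<bar>b\<bar>}"
    using assms by (auto dest!: dvd_imp_le_int)
  then have fin: "finite {p. prime p \<and> int p dvd b}"
    using finite_subset by blast
  have "prime_prod n {p. int p dvd b}
      = (\<Prod>p | prime p \<and> int p dvd b. euler_factor n {p. int p dvd b} p)"
    unfolding prime_prod_def by (rule prodinf_finite[OF fin]) (auto simp: euler_factor_def)
  also have "\<dots> = (\<Prod>p | prime p \<and> int p dvd b. 1 - 1 / real p ^ n)"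
    by (rule prod.cong) (auto simp: euler_factor_def)
  finally show ?thesis .
qed

end

theory Submission
  imports Defs
begin

text \<open>Odd primes cannot compensate for the factor at \<open>2\<close>: by the Weierstrass product inequality and
  the telescoping bound \<open>1/m\<^sup>2 < (1/(m - 1) - 1/(m + 1))/2\<close> over odd \<open>m \<ge> 5\<close>, the product over
  the odd primes is at least \<open>1 - (17/18)/2^n\<close>. An integer \<open>b\<close> is either even, and then its product
  is at most \<open>1 - 1/2^n\<close>, or odd, and then its product is at least that over all odd primes.
  This gap lies in \<open>[1/\<zeta>(n), 1]\<close> because removing the even terms from \<open>\<zeta>(n)\<close> leaves
  \<open>(1 - 1/2^n) \<zeta>(n) \<ge> 1\<close>.\<close>

text \<open>With m = 2j+3, 4/m^2 is below 4/((m-1)(m+1)) = 1/(j+1) - 1/(j+2). The term 4/9 at m = 3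
  is kept exact, so the constant is 4/9 + 1/2 = 17/18; telescoping from m = 3 would give only 1,
  hence no strict gap.\<close>

lemma sum_odd_inverse_squares_le:
  "(\<Sum>j\<le>N. (2 / real (2 * j + 3)) ^ 2) \<le> 17 / 18 - 1 / real (N + 2)"
proof (induction N)
  case 0
  show ?case by (simp add: power2_eq_square)
next
  case (Suc N)
  have "(2 / real (2 * Suc N + 3)) ^ 2 \<le> 1 / real (N + 2) - 1 / real (Suc N + 2)"
    by (simp add: divide_simps power2_eq_square) (simp add: algebra_simps)
  with Suc show ?case by simp
qed

lemma sum_odd_primes_le:
  assumes "n \<ge> 2"
  shows "(\<Sum>p | p \<le> N \<and> prime p \<and> p \<noteq> 2. 1 / real p ^ n) \<le> (17 / 18) / 2 ^ n"
proof -
  have "{p. p \<le> N \<and> prime p \<and> p \<noteq> 2} \<subseteq> (\<lambda>j. 2 * j + 3) ` {..N}"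
  proof
    fix p assume "p \<in> {p. p \<le> N \<and> prime p \<and> p \<noteq> 2}"
    then have p: "p \<le> N" "odd p" "p > 2"
      using prime_ge_2_nat[of p] primes_dvd_imp_eq[of 2 p] by (auto simp: order_less_le)
    then obtain k where "p = 2 * k + 1" by (auto elim: oddE)
    \<comment> \<open>The subtraction does not truncate: p > 2 forces k \<ge> 1.\<close>
    with p have "p = 2 * (k - 1) + 3" "k - 1 \<in> {..N}" by auto
    then show "p \<in> (\<lambda>j. 2 * j + 3) ` {..N}" by blast
  qed
  then have "(\<Sum>p | p \<le> N \<and> prime p \<and> p \<noteq> 2. 1 / real p ^ n)
      \<le> (\<Sum>p\<in>(\<lambda>j. 2 * j + 3) ` {..N}. 1 / real p ^ n)"
    by (intro sum_mono2) auto
  also have "\<dots> = (\<Sum>j\<le>N. (2 / real (2 * j + 3)) ^ n) / 2 ^ n"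
    by (subst sum.reindex) (auto simp: inj_on_def sum_divide_distrib power_divide)
  \<comment> \<open>Each base is below 1, so its powers decrease in the exponent and n = 2 is the
    worst case.\<close>
  also have "\<dots> \<le> (\<Sum>j\<le>N. (2 / real (2 * j + 3)) ^ 2) / 2 ^ n"
    using assms by (intro divide_right_mono sum_mono power_decreasing) auto
  also have "(\<Sum>j\<le>N. (2 / real (2 * j + 3)) ^ 2) \<le> 17 / 18"
    using sum_odd_inverse_squares_le[of N] by (rule order_trans) simp
  finally show ?thesis by (simp add: divide_right_mono)
qed

lemma inverse_prime_power_le_one: "prime p \<Longrightarrow> 1 / real p ^ n \<le> 1"
  using prime_ge_1_nat[of p] by (simp add: one_le_power)

text \<open>All factors lie in [0,1], so additional primes, even infinitely many, can only lower the
  product.\<close>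

lemma prime_prod_antimono:
  assumes "n > 1" and "P \<subseteq> Q"
  shows "prime_prod n Q \<le> prime_prod n P"
  using euler_factor_has_prod[OF assms(1), of Q] euler_factor_has_prod[OF assms(1), of P]
  by (rule has_prod_le)
    (use assms(2) in \<open>auto simp: euler_factor_def inverse_prime_power_le_one\<close>)

lemma prime_prod_empty: "prime_prod n {} = 1"
  using prodinf_finite[of "{}" "euler_factor n {}"] by (simp add: prime_prod_def euler_factor_def)

lemma prime_prod_two: "prime_prod n {2} = 1 - 1 / 2 ^ n"
  using prodinf_finite[of "{2}" "euler_factor n {2}"] by (simp add: prime_prod_def euler_factor_def)

lemma prime_prod_odd_primes_ge:
  assumes "n > 1"
  shows "1 - (17 / 18) / 2 ^ n \<le> prime_prod n {p. p \<noteq> 2}"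
proof (rule LIMSEQ_le_const)
  show "(\<lambda>N. \<Prod>p\<le>N. euler_factor n {p. p \<noteq> 2} p) \<longlonglongrightarrow> prime_prod n {p. p \<noteq> 2}"
    by (rule has_prod_imp_tendsto[OF euler_factor_has_prod[OF assms]])
  have "1 - (17 / 18) / 2 ^ n \<le> (\<Prod>p\<le>N. euler_factor n {p. p \<noteq> 2} p)" for N
  proof -
    let ?A = "{p. p \<le> N \<and> prime p \<and> p \<noteq> 2}"
    have "1 - (17 / 18) / 2 ^ n \<le> 1 - (\<Sum>p\<in>?A. 1 / real p ^ n)"
      using sum_odd_primes_le[of n N] assms by simp
    also have "\<dots> \<le> (\<Prod>p\<in>?A. 1 - 1 / real p ^ n)"
      by (intro Weierstrass_prod_ineq) (auto simp: inverse_prime_power_le_one)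
    also have "\<dots> = (\<Prod>p\<le>N. euler_factor n {p. p \<noteq> 2} p)"
      by (intro prod.mono_neutral_cong_left) (auto simp: euler_factor_def)
    finally show ?thesis .
  qed
  then show "\<exists>M. \<forall>N\<ge>M. 1 - (17 / 18) / 2 ^ n \<le> (\<Prod>p\<le>N. euler_factor n {p. p \<noteq> 2} p)"
    by blast
qed

lemma zeta_inverse_le:
  assumes "n > 1"
  shows "1 / zeta (real n) \<le> 1 - 1 / 2 ^ n"
proof -
  define a where "a k = 1 / real (Suc k) ^ n" for k
  have zeta: "zeta (real n) = suminf a"
    unfolding zeta_def a_def by (simp add: powr_realpow del: of_nat_Suc)
  have "summable (\<lambda>k. 1 / real k ^ n)"
    using inverse_power_summable[of n, where 'a = real] assms by (simp add: field_simps)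
  then have "summable a"
    unfolding a_def by (rule summable_ignore_initial_segment[where k = 1, simplified])
  then have sums: "a sums zeta (real n)"
    unfolding zeta by (rule summable_sums)
  \<comment> \<open>The terms are grouped in pairs. As \<open>a k\<close> belongs to the integer
    k+1, the k-th pair belongs to 2k+1 and 2k+2: the second term is \<open>a k\<close> / 2^n, and
    the first is bounded below by 1 if k = 0 and by 0 otherwise.\<close>
  have "1 / 2 ^ n * zeta (real n) + 1 \<le> zeta (real n)"
  proof (rule sums_le)
    show "(\<lambda>k. 1 / 2 ^ n * a k + (if k = 0 then 1 else 0)) sums (1 / 2 ^ n * zeta (real n) + 1)"
      using sums_single[of 0 "\<lambda>_. 1 :: real"]
      by (intro sums_add sums_mult sums) (simp add: if_distrib eq_commute)
    show "(\<lambda>k. sum a {k * 2..<k * 2 + 2}) sums zeta (real n)"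
      by (rule sums_group[OF sums]) simp
    show "1 / 2 ^ n * a k + (if k = 0 then 1 else 0) \<le> sum a {k * 2..<k * 2 + 2}" for k
    proof -
      have "sum a {k * 2..<k * 2 + 2} = a (2 * k) + a (2 * k + 1)"
        by (simp add: numeral_2_eq_2 mult.commute)
      moreover have "a (2 * k + 1) = 1 / 2 ^ n * a k"
        by (simp add: a_def flip: power_mult_distrib)
      moreover have "a (2 * k) \<ge> (if k = 0 then 1 else 0)"
        by (simp add: a_def)
      ultimately show ?thesis by simp
    qed
  qed
  then have le: "1 \<le> (1 - 1 / 2 ^ n) * zeta (real n)"
    by (simp add: algebra_simps)
  moreover have "(1 - 1 / 2 ^ n :: real) > 0"
    using assms by simp
  ultimately have "zeta (real n) > 0"
    by (smt (verit) mult_nonneg_nonpos)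
  with le show ?thesis by (simp add: pos_divide_le_eq)
qed

theorem theorem5p2:
  fixes n :: nat
  assumes "n > 1"
  shows "1 - 1 / 2 ^ n < prime_prod n {p. p \<noteq> 2}
    \<and> D n \<inter> {1 - 1 / 2 ^ n <..< prime_prod n {p. p \<noteq> 2}} = {}
    \<and> \<not> {1 / zeta (real n) .. 1} \<subseteq> closure (D n)"
proof (intro conjI)
  let ?I = "{1 - 1 / 2 ^ n <..< prime_prod n {p. p \<noteq> 2}}"
  have "(17 / 18) / 2 ^ n < (1 / 2 ^ n :: real)"
    by (simp add: divide_simps)
  with prime_prod_odd_primes_ge[OF assms]
  show gap: "1 - 1 / 2 ^ n < prime_prod n {p. p \<noteq> 2}" by linarith
  have "prime_prod n {p. int p dvd b} \<notin> ?I" for b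
  \<comment> \<open>The value b = 0 falls under the even case.\<close>
  proof (cases "even b")
    case True
    then have "prime_prod n {p. int p dvd b} \<le> prime_prod n {2}"
      by (intro prime_prod_antimono assms) auto
    then show ?thesis by (simp add: prime_prod_two)
  next
    case False
    then have "prime_prod n {p. p \<noteq> 2} \<le> prime_prod n {p. int p dvd b}"
      by (intro prime_prod_antimono assms) auto
    then show ?thesis by simp
  qed
  then show disj: "D n \<inter> ?I = {}"
    by (auto simp: D_def)
  obtain x where x: "x \<in> ?I"
    using dense[OF gap] by auto
  have "prime_prod n {p. p \<noteq> 2} \<le> 1"
    using prime_prod_antimono[OF assms, of "{}"] by (simp add: prime_prod_empty)
  with x zeta_inverse_le[OF assms] have "x \<in> {1 / zeta (real n) .. 1}"
    by simp
  \<comment> \<open>An open set disjoint from \<open>D n\<close> is also disjoint from its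
    closure.\<close>
  moreover have "x \<notin> closure (D n)"
    using open_Int_closure_eq_empty[of ?I "D n"] disj x by auto
  ultimately show "\<not> {1 / zeta (real n) .. 1} \<subseteq> closure (D n)"
    by blast
qed

end
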